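(* For every integer $n\ge1$ there is an orientation (a signing $\sigma$ with values in $\{i,-i\}$) of the Hamming graph $H(n,4)$ such that the oriented graph $H(n,4)^\sigma$ has uniform mixing at time $t=\frac{\pi}{3\sqrt3}$; that is, with $A=A(H(n,4)^\sigma)$, every entry of the matrix $e^{-itA}$ at $t=\frac{\pi}{3\sqrt3}$ has squared modulus $\frac{1}{4^n}$.
   Context: The Hamming graph $H(n,d)$ is the $n$-fold Cartesian product $K_d^{\Box n}$ of the complete graph $K_d$. The Cartesian product $X\Box Y$ has vertex set $V(X)\times V(Y)$ and adjacency matrix $A(X)\otimes I+I\otimes A(Y)$. A signing $\sigma$ of a graph $X$ assigns nonzero complex numbers to the edges so that the matrix $A(X^\sigma)$ with $(a,b)$-entry $\sigma(ab)$ if $ab\in E(X)$, and $0$ otherwise, is Hermitian. If $\sigma$ takes values in $\{i,-i\}$ then $X^\sigma$ is called an oriented graph. For a graph $X$ of order $N$ with Hermitian adjacency matrix $A$, the continuous-time quantum walk is $U_X(t)=e^{-itA}$ and the mixing matrix is $M_X(t)=U_X(t)\circ\overline{U_X(t)}$ (entrywise product). $X$ has uniform mixing at time $t$ if $M_X(t)=\frac1NJ_N$, where $J_N$ is the all-one matrix. *)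

theory Defs
  imports
    Complex_Main
    "Graph_Theory.Kuratowski"
    "Jordan_Normal_Form.Schur_Decomposition"
begin

section \<open>Hamming graphs\<close>

text \<open>Graphs are symmetric loop-free pair digraphs, so an edge \<open>ab\<close> is represented by the two
  arcs \<open>(a, b)\<close> and \<open>(b, a)\<close>.\<close>

definition complete_graph :: "nat \<Rightarrow> nat pair_pre_digraph" where
  "complete_graph d = \<lparr>pverts = {..<d}, parcs = {(a, b). a < d \<and> b < d \<and> a \<noteq> b}\<rparr>"

definition cartesian_prod :: "'a pair_pre_digraph \<Rightarrow> 'b pair_pre_digraph \<Rightarrow> ('a \<times> 'b) pair_pre_digraph"
  where
  "cartesian_prod X Y = \<lparr>pverts = pverts X \<times> pverts Y,
     parcs = {((a, b), (c, d)). (a, c) \<in> parcs X \<and> b = d \<and> b \<in> pverts Y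
                              \<or> a = c \<and> a \<in> pverts X \<and> (b, d) \<in> parcs Y}\<rparr>"

definition relabel :: "('a \<Rightarrow> 'b) \<Rightarrow> 'a pair_pre_digraph \<Rightarrow> 'b pair_pre_digraph" where
  "relabel f X = \<lparr>pverts = f ` pverts X, parcs = map_prod f f ` parcs X\<rparr>"

text \<open>The \<open>n\<close>-tuples of vertices are lists of length \<open>n\<close>: the vertex \<open>(x, xs)\<close> of
  \<open>cartesian_prod X (X ^ n)\<close> is renamed to \<open>x # xs\<close>. The zeroth power is \<open>K\<^sub>1\<close>.\<close>

primrec cartesian_power :: "'a pair_pre_digraph \<Rightarrow> nat \<Rightarrow> 'a list pair_pre_digraph" where
  "cartesian_power X 0 = \<lparr>pverts = {[]}, parcs = {}\<rparr>"
| "cartesian_power X (Suc n) = relabel (\<lambda>(x, xs). x # xs) (cartesian_prod X (cartesian_power X n))"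

definition hamming_graph :: "nat \<Rightarrow> nat \<Rightarrow> nat list pair_pre_digraph" where
  "hamming_graph n d = cartesian_power (complete_graph d) n"


section \<open>Signings\<close>

definition vertex_enum :: "'a pair_pre_digraph \<Rightarrow> 'a list \<Rightarrow> bool" where
  "vertex_enum X vs \<longleftrightarrow> distinct vs \<and> set vs = pverts X"

definition signed_adj_mat ::
  "'a pair_pre_digraph \<Rightarrow> ('a \<Rightarrow> 'a \<Rightarrow> complex) \<Rightarrow> 'a list \<Rightarrow> complex mat" where
  "signed_adj_mat X \<sigma> vs = mat (length vs) (length vs)
     (\<lambda>(i, j). if (vs ! i, vs ! j) \<in> parcs X then \<sigma> (vs ! i) (vs ! j) else 0)"

definition hermitian_mat :: "complex mat \<Rightarrow> bool" where
  "hermitian_mat A \<longleftrightarrow> square_mat A \<and> mat_adjoint A = A"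

text \<open>The value of \<open>\<sigma>\<close> on an edge depends on the direction in which the edge is read
  (\<open>\<sigma> b a = cnj (\<sigma> a b)\<close>, by Hermitian symmetry); values off the edges are irrelevant.\<close>

definition signing :: "'a pair_pre_digraph \<Rightarrow> ('a \<Rightarrow> 'a \<Rightarrow> complex) \<Rightarrow> bool" where
  "signing X \<sigma> \<longleftrightarrow> (\<forall>(a, b) \<in> parcs X. \<sigma> a b \<noteq> 0) \<and>
     (\<forall>vs. vertex_enum X vs \<longrightarrow> hermitian_mat (signed_adj_mat X \<sigma> vs))"

definition orientation :: "'a pair_pre_digraph \<Rightarrow> ('a \<Rightarrow> 'a \<Rightarrow> complex) \<Rightarrow> bool" where
  "orientation X \<sigma> \<longleftrightarrow> signing X \<sigma> \<and> (\<forall>(a, b) \<in> parcs X. \<sigma> a b \<in> {\<i>, - \<i>})"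


section \<open>Continuous-time quantum walks\<close>

text \<open>The entrywise series converge for every square matrix; see \<open>mat_exp_sums\<close> below.\<close>

definition mat_exp :: "complex mat \<Rightarrow> complex mat" where
  "mat_exp A = mat (dim_row A) (dim_col A) (\<lambda>(i, j). \<Sum>k. (A ^\<^sub>m k) $$ (i, j) / fact k)"

definition quantum_walk :: "complex mat \<Rightarrow> real \<Rightarrow> complex mat" where
  "quantum_walk A t = mat_exp ((- \<i> * complex_of_real t) \<cdot>\<^sub>m A)"

definition mixing_matrix :: "complex mat \<Rightarrow> real \<Rightarrow> complex mat" where
  "mixing_matrix A t = mat (dim_row A) (dim_col A)
     (\<lambda>(i, j). quantum_walk A t $$ (i, j) * cnj (quantum_walk A t $$ (i, j)))"

definition uniform_mixing ::
  "'a pair_pre_digraph \<Rightarrow> ('a \<Rightarrow> 'a \<Rightarrow> complex) \<Rightarrow> real \<Rightarrow> bool" where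
  "uniform_mixing X \<sigma> t \<longleftrightarrow> (\<forall>vs. vertex_enum X vs \<longrightarrow>
     mixing_matrix (signed_adj_mat X \<sigma> vs) t
       = mat (card (pverts X)) (card (pverts X)) (\<lambda>_. 1 / of_nat (card (pverts X))))"


section \<open>Basic properties of the definitions\<close>

lemma complete_graph_is_complete: "K\<^bsub>d\<^esub> (with_proj (complete_graph d))"
proof -
  have "parcs (complete_graph d) = {(u, v). (u, v) \<in> {..<d} \<times> {..<d} \<and> u \<noteq> v}"
    by (auto simp: complete_graph_def)
  then show ?thesis
    by (auto simp: complete_digraph_pair_def complete_graph_def)
qed

text \<open>Entrywise form of \<open>A(X \<box> Y) = A(X) \<otimes> I + I \<otimes> A(Y)\<close>.\<close>

lemma cartesian_prod_adjacency:
  assumes "pair_loopfree_digraph X" "pair_loopfree_digraph Y"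
    and "a \<in> pverts X" "c \<in> pverts X" "b \<in> pverts Y" "d \<in> pverts Y"
  shows "(of_bool (((a, b), (c, d)) \<in> parcs (cartesian_prod X Y)) :: complex)
    = of_bool ((a, c) \<in> parcs X) * of_bool (b = d) + of_bool (a = c) * of_bool ((b, d) \<in> parcs Y)"
proof -
  have "(a, a) \<notin> parcs X" "(b, b) \<notin> parcs Y"
    using pair_loopfree_digraph.pair_no_loops[OF assms(1), of "(a, a)"]
      pair_loopfree_digraph.pair_no_loops[OF assms(2), of "(b, b)"] by auto
  then show ?thesis
    using assms by (auto simp: cartesian_prod_def)
qed

lemma pverts_hamming_graph:
  "pverts (hamming_graph n d) = {xs. length xs = n \<and> set xs \<subseteq> {..<d}}"
proof (induction n)
  case 0
  then show ?case by (auto simp: hamming_graph_def)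
next
  case (Suc n)
  have "pverts (hamming_graph (Suc n) d)
      = (\<lambda>(x, xs). x # xs) ` ({..<d} \<times> pverts (hamming_graph n d))"
    by (simp add: hamming_graph_def relabel_def cartesian_prod_def complete_graph_def)
  also have "\<dots> = {xs. length xs = Suc n \<and> set xs \<subseteq> {..<d}}"
    unfolding Suc by (force simp: length_Suc_conv image_iff)
  finally show ?case .
qed

lemma card_hamming_graph: "card (pverts (hamming_graph n d)) = d ^ n"
  using card_lists_length_eq[of "{..<d}" n]
  by (simp add: pverts_hamming_graph conj_commute)

lemma finite_hamming_graph: "finite (pverts (hamming_graph n d))"
  using finite_lists_length_eq[of "{..<d}" n]
  by (simp add: pverts_hamming_graph conj_commute)

lemma parcs_hamming_graph:
  "(xs, ys) \<in> parcs (hamming_graph n d) \<longleftrightarrow>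
     xs \<in> pverts (hamming_graph n d) \<and> ys \<in> pverts (hamming_graph n d) \<and>
     (\<exists>!i. i < n \<and> xs ! i \<noteq> ys ! i)"
proof (induction n arbitrary: xs ys)
  case 0
  then show ?case by (auto simp: hamming_graph_def)
next
  case (Suc n)
  have step: "(xs, ys) \<in> parcs (hamming_graph (Suc n) d) \<longleftrightarrow>
     (\<exists>x xs' y ys'. xs = x # xs' \<and> ys = y # ys' \<and>
        (x < d \<and> y < d \<and> x \<noteq> y \<and> xs' = ys' \<and> xs' \<in> pverts (hamming_graph n d)
         \<or> x = y \<and> x < d \<and> (xs', ys') \<in> parcs (hamming_graph n d)))"
    by (auto simp: hamming_graph_def relabel_def cartesian_prod_def complete_graph_def image_iff
        Bex_def split: prod.splits)
  have shift: "(\<exists>!i. P i) \<longleftrightarrow> (if P 0 then \<forall>i. \<not> P (Suc i) else \<exists>!i. P (Suc i))" for P :: "nat \<Rightarrow> bool"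
  proof (cases "P 0")
    case True
    then have "(\<exists>!i. P i) \<longleftrightarrow> (\<forall>i. P i \<longrightarrow> i = 0)" by blast
    also have "\<dots> \<longleftrightarrow> (\<forall>i. \<not> P (Suc i))" by (metis nat.distinct(1) not0_implies_Suc)
    finally show ?thesis using True by simp
  next
    case False
    have "(\<exists>i. P i) \<longleftrightarrow> (\<exists>i. P (Suc i))" using False by (metis not0_implies_Suc)
    moreover have "(\<forall>i j. P i \<longrightarrow> P j \<longrightarrow> i = j) \<longleftrightarrow> (\<forall>i j. P (Suc i) \<longrightarrow> P (Suc j) \<longrightarrow> i = j)"
      using False by (metis not0_implies_Suc nat.inject)
    ultimately show ?thesis using False by (simp add: Ex1_def) blast
  qed
  have ex1: "(\<exists>!i. i < Suc n \<and> (x # xs') ! i \<noteq> (y # ys') ! i) \<longleftrightarrow>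
      (x \<noteq> y \<and> xs' = ys' \<or> x = y \<and> (\<exists>!i. i < n \<and> xs' ! i \<noteq> ys' ! i))"
    if "length xs' = n" "length ys' = n" for x y :: nat and xs' ys'
    using that by (subst shift) (auto simp: list_eq_iff_nth_eq)
  show ?case
  proof (cases "length xs = Suc n \<and> length ys = Suc n")
    case True
    then obtain x xs' y ys' where eqs: "xs = x # xs'" "ys = y # ys'"
      and len: "length xs' = n" "length ys' = n"
      by (auto simp: length_Suc_conv)
    have "(xs, ys) \<in> parcs (hamming_graph (Suc n) d) \<longleftrightarrow>
        x < d \<and> y < d \<and> x \<noteq> y \<and> xs' = ys' \<and> xs' \<in> pverts (hamming_graph n d)
         \<or> x = y \<and> x < d \<and> (xs', ys') \<in> parcs (hamming_graph n d)"
      unfolding step by (simp add: eqs)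
    also have "\<dots> \<longleftrightarrow> x < d \<and> y < d \<and> set xs' \<subseteq> {..<d} \<and> set ys' \<subseteq> {..<d} \<and>
        (\<exists>!i. i < Suc n \<and> xs ! i \<noteq> ys ! i)"
      unfolding Suc.IH pverts_hamming_graph eqs ex1[OF len] using len by blast
    finally show ?thesis using eqs len by (simp add: pverts_hamming_graph conj_ac)
  next
    case False
    have "(xs, ys) \<notin> parcs (hamming_graph (Suc n) d)"
    proof
      assume "(xs, ys) \<in> parcs (hamming_graph (Suc n) d)"
      then obtain x xs' y ys' where "xs = x # xs'" "ys = y # ys'"
        and c: "xs' = ys' \<and> xs' \<in> pverts (hamming_graph n d)
          \<or> (xs', ys') \<in> parcs (hamming_graph n d)"
        unfolding step by blast
      moreover have "length xs' = n \<and> length ys' = n"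
        using c unfolding Suc.IH pverts_hamming_graph by blast
      ultimately show False using False by simp
    qed
    moreover have "\<not> (xs \<in> pverts (hamming_graph (Suc n) d) \<and> ys \<in> pverts (hamming_graph (Suc n) d))"
      using False unfolding pverts_hamming_graph by blast
    ultimately show ?thesis by blast
  qed
qed

lemma pair_graph_hamming_graph: "pair_graph (hamming_graph n d)"
proof
  show fin: "finite (pverts (hamming_graph n d))" by (rule finite_hamming_graph)
  have sub: "parcs (hamming_graph n d) \<subseteq> pverts (hamming_graph n d) \<times> pverts (hamming_graph n d)"
    by (auto simp only: parcs_hamming_graph mem_Sigma_iff)
  show "fst e \<in> pverts (hamming_graph n d)" "snd e \<in> pverts (hamming_graph n d)"
    if "e \<in> parcs (hamming_graph n d)" for e
    using that sub by auto
  show "finite (parcs (hamming_graph n d))"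
    by (meson fin sub finite_cartesian_product finite_subset)
  show "fst e \<noteq> snd e" if "e \<in> parcs (hamming_graph n d)" for e
    using that by (cases e) (auto simp: parcs_hamming_graph)
  show "symmetric (with_proj (hamming_graph n d))"
  proof -
    have "(ys, xs) \<in> parcs (hamming_graph n d)" if "(xs, ys) \<in> parcs (hamming_graph n d)" for xs ys
      using that unfolding parcs_hamming_graph by (simp add: eq_commute[of "xs ! _"])
    then show ?thesis by (simp add: symmetric_def sym_def)
  qed
qed

lemma mat_exp_sums:
  assumes A: "A \<in> carrier_mat N N" and i: "i < N" and j: "j < N"
  shows "(\<lambda>k. (A ^\<^sub>m k) $$ (i, j) / fact k) sums (mat_exp A $$ (i, j))"
proof -
  define C where "C = (\<Sum>p\<in>{..<N} \<times> {..<N}. cmod (A $$ p))"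
  have C0: "C \<ge> 0" unfolding C_def by (rule sum_nonneg) simp
  have C: "cmod (A $$ (i, j)) \<le> C" if "i < N" "j < N" for i j
    unfolding C_def using that by (intro member_le_sum) auto
  have pw: "A ^\<^sub>m k \<in> carrier_mat N N" for k using A by simp
  have bound: "cmod ((A ^\<^sub>m k) $$ (i, j)) \<le> (of_nat N * C) ^ k" if "i < N" "j < N" for i j k
    using that
  proof (induction k arbitrary: i j)
    case 0
    then show ?case using A by auto
  next
    case (Suc k)
    have "(A ^\<^sub>m Suc k) $$ (i, j) = (\<Sum>l<N. (A ^\<^sub>m k) $$ (i, l) * A $$ (l, j))"
      using Suc.prems A pw[of k] by (simp add: scalar_prod_def lessThan_atLeast0)
    also have "cmod \<dots> \<le> (\<Sum>l<N. (of_nat N * C) ^ k * C)"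
      using Suc C C0 by (intro sum_norm_le) (auto simp: norm_mult intro!: mult_mono)
    also have "\<dots> = (of_nat N * C) ^ Suc k" by (simp add: mult_ac)
    finally show ?case .
  qed
  have "summable (\<lambda>k. (A ^\<^sub>m k) $$ (i, j) / fact k)"
  proof (rule summable_comparison_test)
    show "\<exists>K. \<forall>k\<ge>K. norm ((A ^\<^sub>m k) $$ (i, j) / fact k) \<le> (of_nat N * C) ^ k / fact k"
      using bound[OF i j] by (auto simp: norm_divide divide_right_mono)
    show "summable (\<lambda>k. (of_nat N * C) ^ k / fact k)"
      using summable_exp[of "of_nat N * C"] by (simp add: field_simps)
  qed
  then show ?thesis
    using A i j by (simp add: mat_exp_def summable_sums)
qed

lemma uniform_mixing_iff:
  "uniform_mixing X \<sigma> t \<longleftrightarrow> (\<forall>vs. vertex_enum X vs \<longrightarrow>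
     (\<forall>i<length vs. \<forall>j<length vs.
        (cmod (quantum_walk (signed_adj_mat X \<sigma> vs) t $$ (i, j)))\<^sup>2 = 1 / real (card (pverts X))))"
proof -
  have len: "length vs = card (pverts X)" if "vertex_enum X vs" for vs
    using that distinct_card by (fastforce simp: vertex_enum_def)
  have eq: "z * cnj z = 1 / of_nat m \<longleftrightarrow> (cmod z)\<^sup>2 = 1 / real m" for z m
    by (metis complex_norm_square of_real_1 of_real_divide of_real_eq_iff of_real_of_nat_eq)
  show ?thesis
    unfolding uniform_mixing_def mixing_matrix_def
    by (auto simp: mat_eq_iff eq len signed_adj_mat_def)
qed

end

(* Let u = i + j + k, a quaternion with u^2 = -3, and let row x of the real 4 x 4 matrix S hold the
   coordinates of u e_x for the basis e = (1, i, j, k). Then S is skew with entries 1, -1 off the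
   diagonal and S^2 = -3, so A = sqrt(-1) S is an orientation of K_4 with A^2 = 3, and
   exp(-itA) = cos(sqrt 3 t) I - i (sin(sqrt 3 t) / sqrt 3) A. At sqrt 3 t = pi / 3 both
   coefficients have modulus 1/2, hence so do all entries. Signing each edge of H(n,4) by A in
   the coordinate where its ends differ gives the Kronecker sum of n copies of A, and the
   exponential of a Kronecker sum is the Kronecker product of the exponentials. *)
theory Submission
  imports Defs
begin

section \<open>Exponential series indexed by a finite set\<close>

text \<open>The entries of A^k / k!, with a matrix read as a function on a vertex set. No
  enumeration of the vertices is chosen, so product vertex sets can be treated directly. Dividing by
  \<open>Suc k\<close> at each step builds up the factorial.\<close>

primrec exp_term :: "'a set \<Rightarrow> ('a \<Rightarrow> 'a \<Rightarrow> complex) \<Rightarrow> nat \<Rightarrow> 'a \<Rightarrow> 'a \<Rightarrow> complex" where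
  "exp_term S a 0 x y = of_bool (x = y)"
| "exp_term S a (Suc k) x y = (\<Sum>z\<in>S. exp_term S a k x z * a z y) / of_nat (Suc k)"

text \<open>Both recursions multiply by the matrix on the right, so the row stays fixed in the
  induction; distinctness of \<open>vs\<close> makes the passage from indices to vertices a
  bijection.\<close>

lemma exp_term_eq_pow_mat:
  assumes "distinct vs" and M: "M \<in> carrier_mat (length vs) (length vs)"
    and entry: "\<And>i j. i < length vs \<Longrightarrow> j < length vs \<Longrightarrow> M $$ (i, j) = a (vs ! i) (vs ! j)"
    and "i < length vs" "j < length vs"
  shows "(M ^\<^sub>m k) $$ (i, j) / fact k = exp_term (set vs) a k (vs ! i) (vs ! j)"
  using assms(4,5)
proof (induction k arbitrary: j)
  case 0
  then show ?case using M \<open>distinct vs\<close> by (simp add: nth_eq_iff_index_eq)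
next
  case (Suc k)
  have "M ^\<^sub>m k \<in> carrier_mat (length vs) (length vs)" using M by simp
  then have "(M ^\<^sub>m Suc k) $$ (i, j) = (\<Sum>l<length vs. (M ^\<^sub>m k) $$ (i, l) * M $$ (l, j))"
    using Suc.prems M by (simp add: scalar_prod_def lessThan_atLeast0)
  then have "(M ^\<^sub>m Suc k) $$ (i, j) / fact (Suc k)
      = (\<Sum>l<length vs. (M ^\<^sub>m k) $$ (i, l) / fact k * M $$ (l, j)) / of_nat (Suc k)"
    by (simp add: sum_divide_distrib field_simps)
  also have "\<dots> = (\<Sum>l<length vs. exp_term (set vs) a k (vs ! i) (vs ! l) * a (vs ! l) (vs ! j))
      / of_nat (Suc k)"
    using Suc entry by (intro arg_cong2[where f = "(/)"] sum.cong) auto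
  also have "(\<Sum>l<length vs. exp_term (set vs) a k (vs ! i) (vs ! l) * a (vs ! l) (vs ! j))
      = (\<Sum>z\<in>set vs. exp_term (set vs) a k (vs ! i) z * a z (vs ! j))"
    by (rule sum.reindex_bij_betw[OF bij_betw_nth[OF \<open>distinct vs\<close> refl refl]])
  finally show ?case by simp
qed

text \<open>The sum \<open>C\<close> of all moduli bounds each column sum, so the k-th term has
  modulus at most C^k / k!. Absolute convergence is what the Cauchy product of two such series
  relies on.\<close>

lemma summable_norm_exp_term:
  assumes "finite S" "x \<in> S" "y \<in> S"
  shows "summable (\<lambda>k. norm (exp_term S a k x y))"
proof -
  define C where "C = (\<Sum>p\<in>S \<times> S. cmod (case_prod a p))"
  have C: "(\<Sum>z\<in>S. cmod (a z y)) \<le> C" if "y \<in> S" for y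
  proof -
    have "(\<Sum>z\<in>S. cmod (a z y)) \<le> (\<Sum>z\<in>S. \<Sum>w\<in>S. cmod (a z w))"
      using assms(1) that by (intro sum_mono member_le_sum) auto
    then show ?thesis by (simp add: C_def sum.cartesian_product case_prod_unfold)
  qed
  have C0: "C \<ge> 0" unfolding C_def by (rule sum_nonneg) simp
  have bound: "cmod (exp_term S a k x y) \<le> C ^ k / fact k" if "y \<in> S" for y k
    using that
  proof (induction k arbitrary: y)
    case 0
    then show ?case by simp
  next
    case (Suc k)
    have "cmod (\<Sum>z\<in>S. exp_term S a k x z * a z y) \<le> (\<Sum>z\<in>S. C ^ k / fact k * cmod (a z y))"
      using Suc.IH by (intro sum_norm_le) (simp only: norm_mult, intro mult_right_mono, auto)
    also have "\<dots> = C ^ k / fact k * (\<Sum>z\<in>S. cmod (a z y))"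
      by (simp add: sum_distrib_left)
    also have "\<dots> \<le> C ^ k / fact k * C"
      using C[OF Suc.prems] C0 by (intro mult_left_mono) auto
    finally have "cmod (\<Sum>z\<in>S. exp_term S a k x z * a z y) / real (Suc k)
        \<le> C ^ k / fact k * C / real (Suc k)"
      by (rule divide_right_mono) simp
    also have "\<dots> = C ^ Suc k / fact (Suc k)" by (simp add: field_simps)
    finally show ?case by (simp add: norm_divide del: of_nat_Suc)
  qed
  show ?thesis
  proof (rule summable_comparison_test)
    show "\<exists>K. \<forall>k\<ge>K. norm (norm (exp_term S a k x y)) \<le> C ^ k / fact k"
      using bound[OF assms(3)] by auto
    show "summable (\<lambda>k. C ^ k / fact k)"
      using summable_exp[of C] by (simp add: field_simps)
  qed
qed

section \<open>Kronecker sums and Hamming graphs\<close>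

text \<open>The binomial theorem for the commuting matrices A x I and I x B (Kronecker products),
  divided by k! so that the binomial coefficients disappear. It is proved entrywise by induction on
  \<open>k\<close>.\<close>

lemma exp_term_Kronecker_sum:
  assumes fin: "finite S" "finite T"
    and c: "\<And>x y xs ys. c (x # xs) (y # ys)
      = of_bool (xs = ys) * a x y + of_bool (x = y) * b xs ys"
    and "y \<in> S" "ys \<in> T"
  shows "exp_term ((\<lambda>(x, xs). x # xs) ` (S \<times> T)) c k (x # xs) (y # ys)
    = (\<Sum>j\<le>k. exp_term S a j x y * exp_term T b (k - j) xs ys)"
  using assms(4,5)
proof (induction k arbitrary: y ys)
  case 0
  then show ?case by simp
next
  case (Suc k)
  let ?W = "(\<lambda>(x, xs). x # xs) ` (S \<times> T)"
  define p where "p = exp_term S a"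
  define q where "q = exp_term T b"
  define r where "r z zs = (\<Sum>j\<le>k. p j x z * q (k - j) xs zs)" for z zs
  \<comment> \<open>The recursion of \<open>exp_term\<close> with its denominator cleared: a
    multiplication by \<open>a\<close> raises the index and produces the factor
    \<open>Suc j\<close>.\<close>
  have p: "(\<Sum>z\<in>S. p j x z * a z y) = of_nat (Suc j) * p (Suc j) x y" for j
    unfolding p_def by (simp del: of_nat_Suc)
  have q: "(\<Sum>z\<in>T. q j xs z * b z ys) = of_nat (Suc j) * q (Suc j) xs ys" for j
    unfolding q_def by (simp del: of_nat_Suc)
  have "(\<Sum>w\<in>?W. exp_term ?W c k (x # xs) w * c w (y # ys))
      = (\<Sum>(z, zs)\<in>S \<times> T. exp_term ?W c k (x # xs) (z # zs) * c (z # zs) (y # ys))"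
    by (subst sum.reindex) (auto simp: inj_on_def case_prod_unfold)
  also have "\<dots> = (\<Sum>(z, zs)\<in>S \<times> T. r z zs *
      (of_bool (zs = ys) * a z y + of_bool (z = y) * b zs ys))"
    unfolding r_def p_def q_def by (intro sum.cong) (auto simp: Suc.IH c)
  also have "\<dots> = (\<Sum>z\<in>S. \<Sum>zs\<in>T. of_bool (zs = ys) * (r z zs * a z y)
      + of_bool (z = y) * (r z zs * b zs ys))"
    unfolding sum.cartesian_product by (intro sum.cong) (auto simp: distrib_left)
  also have "\<dots> = (\<Sum>z\<in>S. \<Sum>zs\<in>T. of_bool (zs = ys) * (r z zs * a z y))
      + (\<Sum>zs\<in>T. \<Sum>z\<in>S. of_bool (z = y) * (r z zs * b zs ys))"
    unfolding sum.distrib by (rule arg_cong2[where f = "(+)", OF refl sum.swap])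
  also have "\<dots> = (\<Sum>z\<in>S. r z ys * a z y) + (\<Sum>zs\<in>T. r y zs * b zs ys)"
    using Suc.prems fin by (simp add: of_bool_def if_distrib[of "\<lambda>u. u * _"] sum.delta cong: if_cong)
  also have "(\<Sum>z\<in>S. r z ys * a z y) = (\<Sum>j\<le>k. of_nat (Suc j) * p (Suc j) x y * q (k - j) xs ys)"
    unfolding r_def p[symmetric] sum_distrib_right
    by (subst sum.swap) (simp add: mult_ac)
  also have "(\<Sum>zs\<in>T. r y zs * b zs ys)
      = (\<Sum>j\<le>k. p j x y * (of_nat (Suc (k - j)) * q (Suc (k - j)) xs ys))"
    unfolding r_def q[symmetric] sum_distrib_right sum_distrib_left
    by (subst sum.swap) (simp add: mult_ac)
  \<comment> \<open>Both sums are extended to the range j \<le> k + 1. The added term has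
    coefficient 0: it is j = 0 here, after a shift, and j = k + 1 in the next step.\<close>
  also have "(\<Sum>j\<le>k. of_nat (Suc j) * p (Suc j) x y * q (k - j) xs ys)
      = (\<Sum>j\<le>Suc k. of_nat j * (p j x y * q (Suc k - j) xs ys))"
    by (subst sum.atMost_Suc_shift) (simp add: mult_ac del: of_nat_Suc)
  also have "(\<Sum>j\<le>k. p j x y * (of_nat (Suc (k - j)) * q (Suc (k - j)) xs ys))
      = (\<Sum>j\<le>Suc k. of_nat (Suc k - j) * (p j x y * q (Suc k - j) xs ys))"
    by (simp add: Suc_diff_le mult_ac del: of_nat_Suc of_nat_diff)
  \<comment> \<open>The coefficients j and k + 1 - j add up to k + 1, which the denominator in
    \<open>exp_term\<close> cancels.\<close>
  also have "(\<Sum>j\<le>Suc k. of_nat j * (p j x y * q (Suc k - j) xs ys))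
        + (\<Sum>j\<le>Suc k. of_nat (Suc k - j) * (p j x y * q (Suc k - j) xs ys))
      = of_nat (Suc k) * (\<Sum>j\<le>Suc k. p j x y * q (Suc k - j) xs ys)"
    unfolding sum.distrib[symmetric] sum_distrib_left distrib_right[symmetric] of_nat_add[symmetric]
    by (intro sum.cong) auto
  finally show ?case unfolding p_def q_def by (simp del: of_nat_Suc sum.atMost_Suc)
qed

text \<open>One function on lists serves every \<open>n\<close>. The default 0 makes it the zero
  matrix on the single vertex \<open>[]\<close> of the zeroth power, and also applies to lists of
  different lengths.\<close>

fun Kronecker_sum :: "('a \<Rightarrow> 'a \<Rightarrow> complex) \<Rightarrow> 'a list \<Rightarrow> 'a list \<Rightarrow> complex" where
  "Kronecker_sum a (x # xs) (y # ys)
    = of_bool (xs = ys) * a x y + of_bool (x = y) * Kronecker_sum a xs ys"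
| "Kronecker_sum a _ _ = 0"

lemma Kronecker_sum_scale: "Kronecker_sum (\<lambda>x y. c * a x y) xs ys = c * Kronecker_sum a xs ys"
  by (induction a xs ys rule: Kronecker_sum.induct) (auto simp: algebra_simps)

lemma Kronecker_sum_hermitian:
  assumes "\<And>x y. a y x = cnj (a x y)"
  shows "Kronecker_sum a ys xs = cnj (Kronecker_sum a xs ys)"
  by (induction xs ys rule: list_induct2') (auto simp: assms[symmetric])

lemma pverts_hamming_graph_Suc:
  "pverts (hamming_graph (Suc n) d) = (\<lambda>(x, xs). x # xs) ` ({..<d} \<times> pverts (hamming_graph n d))"
  by (simp add: hamming_graph_def relabel_def cartesian_prod_def complete_graph_def)

lemma parcs_hamming_graph_Suc:
  "(x # xs, y # ys) \<in> parcs (hamming_graph (Suc n) d) \<longleftrightarrow>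
     x < d \<and> y < d \<and> x \<noteq> y \<and> xs = ys \<and> xs \<in> pverts (hamming_graph n d)
   \<or> x = y \<and> x < d \<and> (xs, ys) \<in> parcs (hamming_graph n d)"
  by (auto simp: hamming_graph_def relabel_def cartesian_prod_def complete_graph_def image_iff
      Bex_def split: prod.splits)

text \<open>As \<open>a\<close> vanishes on the diagonal, a summand survives only if the two lists
  agree in all coordinates but one, that is, on an arc. Which coordinate this is does not matter
  later, so only the values of \<open>a\<close> are recorded.\<close>

lemma Kronecker_sum_on_hamming_graph:
  assumes diag: "\<And>x. a x x = 0"
    and "xs \<in> pverts (hamming_graph n d)" "ys \<in> pverts (hamming_graph n d)"
  shows "if (xs, ys) \<in> parcs (hamming_graph n d)
    then \<exists>x<d. \<exists>y<d. x \<noteq> y \<and> Kronecker_sum a xs ys = a x y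
    else Kronecker_sum a xs ys = 0"
  using assms(2,3)
proof (induction n arbitrary: xs ys)
  case 0
  then show ?case by (auto simp: hamming_graph_def)
next
  case (Suc n)
  from Suc.prems obtain x xs' y ys' where eqs: "xs = x # xs'" "ys = y # ys'"
    and mem: "x < d" "y < d" "xs' \<in> pverts (hamming_graph n d)" "ys' \<in> pverts (hamming_graph n d)"
    by (auto simp: pverts_hamming_graph_Suc)
  have loop: "(xs', xs') \<notin> parcs (hamming_graph n d)" by (simp add: parcs_hamming_graph Ex1_def)
  have "Kronecker_sum a xs' xs' = 0" using Suc.IH[OF mem(3) mem(3)] loop by simp
  then show ?case
    using Suc.IH[OF mem(3,4)] mem loop diag unfolding eqs parcs_hamming_graph_Suc
    by (cases "x = y"; cases "xs' = ys'") auto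
qed

text \<open>The exponential of a Kronecker sum is the Kronecker product of the exponentials; by
  induction on \<open>n\<close>, an entry is the product over the coordinates of entries
  \<open>E\<close> of the exponential of \<open>a\<close>.\<close>

lemma exp_term_hamming_graph_sums:
  assumes E: "\<And>x y. x < d \<Longrightarrow> y < d \<Longrightarrow> (\<lambda>k. exp_term {..<d} a k x y) sums E x y"
    and "xs \<in> pverts (hamming_graph n d)" "ys \<in> pverts (hamming_graph n d)"
  shows "(\<lambda>k. exp_term (pverts (hamming_graph n d)) (Kronecker_sum a) k xs ys)
    sums prod_list (map2 E xs ys)"
  using assms(2,3)
proof (induction n arbitrary: xs ys)
  case 0
  \<comment> \<open>The exponential of the 1 x 1 zero matrix is 1, the empty product.\<close>
  have "exp_term {[]} (Kronecker_sum a) k [] [] = (if k = 0 then 1 else 0)" for k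
    by (cases k) auto
  then show ?case
    using 0 sums_single[of 0 "\<lambda>_. 1 :: complex"] by (simp add: hamming_graph_def)
next
  case (Suc n)
  let ?T = "pverts (hamming_graph n d)"
  from Suc.prems obtain x xs' y ys' where eqs: "xs = x # xs'" "ys = y # ys'"
    and mem: "x < d" "y < d" "xs' \<in> ?T" "ys' \<in> ?T"
    by (auto simp: pverts_hamming_graph_Suc)
  have "(\<lambda>k. \<Sum>j\<le>k. exp_term {..<d} a j x y * exp_term ?T (Kronecker_sum a) (k - j) xs' ys')
      sums ((\<Sum>k. exp_term {..<d} a k x y) * (\<Sum>k. exp_term ?T (Kronecker_sum a) k xs' ys'))"
    using mem finite_hamming_graph by (intro Cauchy_product_sums summable_norm_exp_term) auto
  also have "(\<Sum>k. exp_term {..<d} a k x y) = E x y"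
    using E[OF mem(1,2)] by (rule sums_unique[symmetric])
  also have "(\<Sum>k. exp_term ?T (Kronecker_sum a) k xs' ys') = prod_list (map2 E xs' ys')"
    using Suc.IH[OF mem(3,4)] by (rule sums_unique[symmetric])
  finally show ?case
    unfolding eqs pverts_hamming_graph_Suc
    using mem finite_hamming_graph
    by (subst exp_term_Kronecker_sum) (auto simp del: Kronecker_sum.simps simp: Kronecker_sum.simps(1))
qed

lemma orientation_Kronecker_sum:
  assumes herm: "\<And>x y. a y x = cnj (a x y)"
    and val: "\<And>x y. x < d \<Longrightarrow> y < d \<Longrightarrow> x \<noteq> y \<Longrightarrow> a x y \<in> {\<i>, - \<i>}"
    and diag: "\<And>x. a x x = 0"
  shows "orientation (hamming_graph n d) (Kronecker_sum a)"
proof -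
  let ?X = "hamming_graph n d"
  have arc: "Kronecker_sum a xs ys \<in> {\<i>, - \<i>}" if e: "(xs, ys) \<in> parcs ?X" for xs ys
  proof -
    have "xs \<in> pverts ?X" "ys \<in> pverts ?X" using e by (simp_all add: parcs_hamming_graph)
    then show ?thesis
      using Kronecker_sum_on_hamming_graph[where a = a and xs = xs and ys = ys, OF diag] e val
      by fastforce
  qed
  have sym: "(ys, xs) \<in> parcs ?X \<longleftrightarrow> (xs, ys) \<in> parcs ?X" for xs ys
    unfolding parcs_hamming_graph by (auto simp: eq_commute[of "xs ! _"])
  have "hermitian_mat (signed_adj_mat ?X (Kronecker_sum a) vs)" for vs
    unfolding hermitian_mat_def signed_adj_mat_def
    by (auto simp: mat_adjoint_def mat_of_rows_def sym intro!: eq_matI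
        Kronecker_sum_hermitian[OF herm, symmetric])
  then show ?thesis
    using arc unfolding orientation_def signing_def by fastforce
qed

text \<open>The same series is summed twice, once as the matrix exponential and once as a product
  over coordinates. The factor -it is first moved inside the Kronecker sum.\<close>

lemma quantum_walk_Kronecker_sum:
  assumes E: "\<And>x y. x < d \<Longrightarrow> y < d \<Longrightarrow>
      (\<lambda>k. exp_term {..<d} (\<lambda>x y. - \<i> * complex_of_real t * a x y) k x y) sums E x y"
    and diag: "\<And>x. a x x = 0"
    and vs: "vertex_enum (hamming_graph n d) vs"
    and ij: "i < length vs" "j < length vs"
  shows "quantum_walk (signed_adj_mat (hamming_graph n d) (Kronecker_sum a) vs) t $$ (i, j)
    = prod_list (map2 E (vs ! i) (vs ! j))"
proof -
  let ?X = "hamming_graph n d" and ?c = "- \<i> * complex_of_real t"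
  let ?w = "Kronecker_sum (\<lambda>x y. ?c * a x y)"
  let ?M = "?c \<cdot>\<^sub>m signed_adj_mat ?X (Kronecker_sum a) vs"
  have dist: "distinct vs" and V: "set vs = pverts ?X"
    using vs by (auto simp: vertex_enum_def)
  have M: "?M \<in> carrier_mat (length vs) (length vs)" by (simp add: signed_adj_mat_def)
  have entry: "?M $$ (i, j) = ?w (vs ! i) (vs ! j)" if "i < length vs" "j < length vs" for i j
  proof -
    have "vs ! i \<in> pverts ?X" "vs ! j \<in> pverts ?X" using that V nth_mem by blast+
    \<comment> \<open>Off the arcs the Kronecker sum is already 0, so restricting it to arcs in
      \<open>signed_adj_mat\<close> changes nothing.\<close>
    then have "(vs ! i, vs ! j) \<notin> parcs ?X \<Longrightarrow> Kronecker_sum a (vs ! i) (vs ! j) = 0"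
      using Kronecker_sum_on_hamming_graph[where a = a and xs = "vs ! i" and ys = "vs ! j", OF diag] by simp
    then show ?thesis
      using that unfolding Kronecker_sum_scale by (auto simp: signed_adj_mat_def)
  qed
  have "(\<lambda>k. exp_term (set vs) ?w k (vs ! i) (vs ! j)) sums (mat_exp ?M $$ (i, j))"
    using mat_exp_sums[OF M ij] exp_term_eq_pow_mat[where a = ?w, OF dist M entry ij] by simp
  moreover have "(\<lambda>k. exp_term (set vs) ?w k (vs ! i) (vs ! j))
      sums prod_list (map2 E (vs ! i) (vs ! j))"
    unfolding V
  proof (rule exp_term_hamming_graph_sums[OF E])
    show "vs ! i \<in> pverts ?X" "vs ! j \<in> pverts ?X" using ij V nth_mem by blast+
  qed
  ultimately show ?thesis unfolding quantum_walk_def by (rule sums_unique2)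
qed

section \<open>Exponentials of matrices with scalar square\<close>

text \<open>The powers of \<open>a\<close> are r^k I for even k and r^(k-1) \<open>a\<close> for odd
  k. Writing both parities through r^k and (-r)^k, the powers of the possible eigenvalues, lets the
  series be summed by \<open>exp\<close>.\<close>

lemma exp_term_of_square_scalar:
  assumes "finite S" and "r \<noteq> 0"
    and sq: "\<And>x y. x \<in> S \<Longrightarrow> y \<in> S \<Longrightarrow> (\<Sum>z\<in>S. a x z * a z y) = r\<^sup>2 * of_bool (x = y)"
    and "x \<in> S" "y \<in> S"
  shows "exp_term S (\<lambda>x y. c * a x y) k x y = c ^ k / fact k *
    ((r ^ k + (- r) ^ k) / 2 * of_bool (x = y) + (r ^ k - (- r) ^ k) / (2 * r) * a x y)"
  using assms(5)
proof (induction k arbitrary: y)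
  case 0
  then show ?case by simp
next
  case (Suc k)
  \<comment> \<open>The coefficients of I and \<open>a\<close> in the k-th power. Multiplication by
    \<open>a\<close> turns (\<alpha>, \<beta>) into (r^2 \<beta>, \<alpha>), which is the pair for k
    + 1.\<close>
  define \<alpha> where "\<alpha> = (r ^ k + (- r) ^ k) / 2"
  define \<beta> where "\<beta> = (r ^ k - (- r) ^ k) / (2 * r)"
  have "(\<Sum>z\<in>S. exp_term S (\<lambda>x y. c * a x y) k x z * (c * a z y))
      = (\<Sum>z\<in>S. c ^ k / fact k * (\<alpha> * of_bool (x = z) + \<beta> * a x z) * (c * a z y))"
    unfolding \<alpha>_def \<beta>_def by (intro sum.cong) (simp_all add: Suc.IH)
  also have "\<dots> = c ^ Suc k / fact k *
      (\<alpha> * (\<Sum>z\<in>S. of_bool (x = z) * a z y) + \<beta> * (\<Sum>z\<in>S. a x z * a z y))"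
    by (simp add: sum_distrib_left sum.distrib algebra_simps)
  also have "(\<Sum>z\<in>S. of_bool (x = z) * a z y) = a x y"
    using assms(1,4) by (simp add: of_bool_def if_distrib[of "\<lambda>u. u * _"] sum.delta cong: if_cong)
  also have "(\<Sum>z\<in>S. a x z * a z y) = r\<^sup>2 * of_bool (x = y)"
    using assms(4) Suc.prems by (rule sq)
  also have "\<beta> * (r\<^sup>2 * of_bool (x = y)) = (r ^ Suc k + (- r) ^ Suc k) / 2 * of_bool (x = y)"
    using \<open>r \<noteq> 0\<close> by (simp add: \<beta>_def field_simps power2_eq_square)
  also have "\<alpha> = (r ^ Suc k - (- r) ^ Suc k) / (2 * r)"
    using \<open>r \<noteq> 0\<close> by (simp add: \<alpha>_def field_simps)
  finally show ?case
    by (simp del: of_nat_Suc power_Suc add: fact_Suc add.commute mult.commute)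
qed

text \<open>Termwise, this combines the exponential series at cr and -cr; their half sum and half
  difference are \<open>cosh\<close> and \<open>sinh\<close>.\<close>

lemma exp_term_of_square_scalar_sums:
  assumes "finite S" and "r \<noteq> 0"
    and "\<And>x y. x \<in> S \<Longrightarrow> y \<in> S \<Longrightarrow> (\<Sum>z\<in>S. a x z * a z y) = r\<^sup>2 * of_bool (x = y)"
    and "x \<in> S" "y \<in> S"
  shows "(\<lambda>k. exp_term S (\<lambda>x y. c * a x y) k x y) sums
    (cosh (c * r) * of_bool (x = y) + sinh (c * r) / r * a x y)"
proof -
  have e: "(\<lambda>k. (c * s) ^ k / fact k) sums exp (c * s)" for s
    using exp_converges[of "c * s"] by (simp add: scaleR_conv_of_real field_simps)
  have "(\<lambda>k. ((c * r) ^ k / fact k + (c * - r) ^ k / fact k) / 2 * of_bool (x = y)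
        + ((c * r) ^ k / fact k - (c * - r) ^ k / fact k) / (2 * r) * a x y)
      sums ((exp (c * r) + exp (c * - r)) / 2 * of_bool (x = y)
        + (exp (c * r) - exp (c * - r)) / (2 * r) * a x y)"
    by (intro sums_add sums_diff sums_mult2 sums_divide e)
  also have "(\<lambda>k. ((c * r) ^ k / fact k + (c * - r) ^ k / fact k) / 2 * of_bool (x = y)
        + ((c * r) ^ k / fact k - (c * - r) ^ k / fact k) / (2 * r) * a x y)
      = (\<lambda>k. exp_term S (\<lambda>x y. c * a x y) k x y)"
    by (rule ext, subst exp_term_of_square_scalar[where a = a and r = r, OF assms])
      (auto simp: power_mult_distrib algebra_simps add_divide_distrib diff_divide_distrib
        simp del: mult_minus_right)
  finally show ?thesis by (simp add: cosh_def sinh_def scaleR_conv_of_real field_simps)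
qed

section \<open>The quaternionic signing of the complete graph on four vertices\<close>

text \<open>The vertices 0, 1, 2, 3 stand for the quaternions 1, i, j, k, and the listed pairs are
  the cyclic order of i, j, k. The final 0 is reached only by distinct nonzero labels of which one
  is at least 4; the matrix is Hermitian on all labels.\<close>

definition K4_signing :: "nat \<Rightarrow> nat \<Rightarrow> complex" where
  "K4_signing x y = (if x = y then 0
     else if x = 0 \<or> y \<noteq> 0 \<and> (x, y) \<in> {(1, 2), (2, 3), (3, 1)} then \<i>
     else if y = 0 \<or> (y, x) \<in> {(1, 2), (2, 3), (3, 1)} then - \<i> else 0)"

text \<open>This is u^2 = -3 for u = i + j + k, verified on all 16 entries.\<close>

lemma K4_signing_square:
  assumes "x \<in> {..<4}" "y \<in> {..<4}"
  shows "(\<Sum>z<4. K4_signing x z * K4_signing z y) = 3 * of_bool (x = y)"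
proof -
  have "x \<in> {0, 1, 2, 3}" "y \<in> {0, 1, 2, 3}" using assms by auto
  then show ?thesis
    by (elim insertE emptyE) (simp_all add: K4_signing_def eval_nat_numeral)
qed

lemma K4_signing_value:
  assumes "x < 4" "y < 4" "x \<noteq> y"
  shows "K4_signing x y \<in> {\<i>, - \<i>}"
proof -
  have "x \<in> {0, 1, 2, 3}" "y \<in> {0, 1, 2, 3}" using assms by auto
  then show ?thesis using assms(3) by (auto simp: K4_signing_def)
qed

lemma norm_prod_list_map2:
  fixes E :: "'a \<Rightarrow> 'b \<Rightarrow> complex"
  assumes "length xs = length ys" "\<And>x y. x \<in> set xs \<Longrightarrow> y \<in> set ys \<Longrightarrow> cmod (E x y) = u"
  shows "cmod (prod_list (map2 E xs ys)) = u ^ length xs"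
  using assms by (induction xs ys rule: list_induct2) (auto simp: norm_mult)

section \<open>Equal moduli at the mixing time\<close>

theorem theorem3:
  fixes n :: nat
  assumes "n \<ge> 1"
  shows "\<exists>\<sigma>. orientation (hamming_graph n 4) \<sigma> \<and>
             uniform_mixing (hamming_graph n 4) \<sigma> (pi / (3 * sqrt 3))"
proof (intro exI conjI)
  let ?a = K4_signing and ?t = "pi / (3 * sqrt 3)"
  \<comment> \<open>With \<theta> = t sqrt 3, the entries for one factor have equal moduli iff |cos
    \<theta>| = |sin \<theta>| / sqrt 3. The given t makes \<theta> = \<pi>/3, a solution, and
    \<open>?c * ?r\<close> is -i \<theta>.\<close>
  let ?c = "- \<i> * complex_of_real ?t" and ?r = "complex_of_real (sqrt 3)"
  define E where "E x y = cosh (?c * ?r) * of_bool (x = y) + sinh (?c * ?r) / ?r * ?a x y" for x y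
  have herm: "?a y x = cnj (?a x y)" for x y
    by (auto simp: K4_signing_def)
  have diag: "?a x x = 0" for x by (simp add: K4_signing_def)
  show "orientation (hamming_graph n 4) (Kronecker_sum ?a)"
    by (intro orientation_Kronecker_sum herm K4_signing_value diag)
  have r2: "?r\<^sup>2 = 3" by (simp flip: of_real_power)
  have sums: "(\<lambda>k. exp_term {..<4} (\<lambda>x y. ?c * ?a x y) k x y) sums E x y"
    if "x < 4" "y < 4" for x y
    unfolding E_def
    using that K4_signing_square by (intro exp_term_of_square_scalar_sums) (auto simp: r2)
  have cr: "?c * ?r = - (\<i> * complex_of_real (pi / 3))" by (simp add: field_simps)
  have exps: "exp (?c * ?r) = cis (- (pi / 3))" "exp (- (?c * ?r)) = cis (pi / 3)"
    unfolding cr by (simp_all add: cis_conv_exp)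
  have ch: "cosh (?c * ?r) = 1 / 2"
    unfolding cosh_def exps by (simp add: complex_eq_iff cos_60)
  have "sinh (?c * ?r) = - \<i> * complex_of_real (sqrt 3 / 2)"
    unfolding sinh_def exps by (simp add: complex_eq_iff sin_60)
  then have sh: "sinh (?c * ?r) / ?r = - \<i> / 2" by simp
  \<comment> \<open>On the diagonal only the \<open>cosh\<close> term 1/2 remains; off it, -i/2 is
    multiplied by i or -i.\<close>
  have half: "cmod (E x y) = 1 / 2" if "x < 4" "y < 4" for x y
    using K4_signing_value[OF that] unfolding E_def ch sh
    by (cases "x = y") (auto simp: diag norm_divide)
  show "uniform_mixing (hamming_graph n 4) (Kronecker_sum ?a) ?t"
    unfolding uniform_mixing_iff
  proof (intro allI impI)
    fix vs i j
    assume vs: "vertex_enum (hamming_graph n 4) vs" and ij: "i < length vs" "j < length vs"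
    have "vs ! i \<in> pverts (hamming_graph n 4)" "vs ! j \<in> pverts (hamming_graph n 4)"
      using vs ij nth_mem unfolding vertex_enum_def by blast+
    then have mem: "length (vs ! i) = n" "length (vs ! j) = n"
      "set (vs ! i) \<subseteq> {..<4}" "set (vs ! j) \<subseteq> {..<4}"
      by (simp_all add: pverts_hamming_graph)
    have walk: "quantum_walk (signed_adj_mat (hamming_graph n 4) (Kronecker_sum ?a) vs) ?t $$ (i, j)
        = prod_list (map2 E (vs ! i) (vs ! j))"
      by (rule quantum_walk_Kronecker_sum[OF sums diag vs ij])
    have "cmod (prod_list (map2 E (vs ! i) (vs ! j))) = (1 / 2) ^ n"
      using norm_prod_list_map2[of "vs ! i" "vs ! j" E "1 / 2"] half mem by fastforce
    \<comment> \<open>Each of the n coordinates contributes modulus 1/2, so the squared modulus is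
      1/4^n, the reciprocal of the number of vertices.\<close>
    moreover have "((1 / 2) ^ n)\<^sup>2 = 1 / real (4 ^ n)"
      by (simp add: power2_eq_square power_one_over flip: power_mult_distrib)
    ultimately show "(cmod (quantum_walk (signed_adj_mat (hamming_graph n 4) (Kronecker_sum ?a) vs) ?t
        $$ (i, j)))\<^sup>2 = 1 / real (card (pverts (hamming_graph n 4)))"
      by (simp only: walk card_hamming_graph)
  qed
qed

end
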